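(* Let $q$ be a prime power, let $k\geq 2$ and $n\geq 1$ be integers such that $k+1$ divides $n$, and let $\mathcal{S}=\{W_1,\ldots,W_m\}$ be a $(k+1)$-spread of $V(n,q)$. Let $\mathcal{M}$ denote the union of the collections of all $k$-dimensional subspaces of each $W_i$; that is, \[ \mathcal{M} = \bigcup_{i=1}^m \{U\leq W_i \, : \, \dim(U)=k \}. \] Then $\mathcal{M}$ is a resolving set for the Grassmann graph $G_q(n,k)$, and $|\mathcal{M}|={n \brack 1}_q=\frac{q^n-1}{q-1}$.
   Context: $V(n,q)$ denotes the $n$-dimensional vector space over the finite field $\mathbb{F}_q$; $U\leq W$ means that $U$ is a subspace of $W$. The Grassmann graph $G_q(n,k)$ has as its vertex set the set of all $k$-dimensional subspaces of $V(n,q)$; two vertices are adjacent if the corresponding subspaces intersect in a subspace of dimension $k-1$. (The graph distance between vertices $X$ and $Y$ is $k-\dim(X\cap Y)$.) A resolving set for a graph $\Gamma=(V,E)$ is a set of vertices $S=\{v_1,\ldots,v_r\}$ such that for all $u,w\in V$, the lists of graph distances $(d(u,v_1),\ldots,d(u,v_r))$ and $(d(w,v_1),\ldots,d(w,v_r))$ are equal if and only if $u=w$. A $t$-spread of $V(n,q)$ is a collection of $t$-dimensional subspaces $\{W_1,\ldots,W_m\}$ such that (i) any non-zero vector $x\in V(n,q)$ belongs to exactly one $W_i$; and (ii) if $i\neq j$, then $W_i\cap W_j=\{0\}$. The Gaussian binomial coefficient ${n \brack 1}_q=\frac{q^n-1}{q-1}$ is the number of $1$-dimensional subspaces of $V(n,q)$.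 *)

theory Defs
  imports "HOL-Analysis.Cartesian_Space" "Graph_Theory.Pair_Digraph" "Graph_Theory.Shortest_Path"
begin

definition k_subspaces :: "nat \<Rightarrow> ('a::field ^ 'n) set set" where
  "k_subspaces k = {U. vec.subspace U \<and> vec.dim U = k}"

(* Intersection of dimension k - 1, written without truncated subtraction, so that there is
   no loop for k = 0. An undirected edge is represented by its two arcs. *)
definition grassmann_graph :: "nat \<Rightarrow> ('a::field ^ 'n) set pair_pre_digraph" where
  "grassmann_graph k =
    \<lparr> pverts = k_subspaces k,
      parcs = {(X, Y). X \<in> k_subspaces k \<and> Y \<in> k_subspaces k \<and> vec.dim (X \<inter> Y) + 1 = k} \<rparr>"

lemma graph_grassmann_graph:
  "graph (with_proj (grassmann_graph k :: ('a::{field,finite} ^ 'n) set pair_pre_digraph))"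
proof
  let ?G = "with_proj (grassmann_graph k :: ('a ^ 'n) set pair_pre_digraph)"
  have "finite (UNIV :: ('a ^ 'n) set set)" "finite (UNIV :: (('a ^ 'n) set \<times> ('a ^ 'n) set) set)"
    by (rule finite_class.finite_UNIV)+
  then show "finite (verts ?G)" "finite (arcs ?G)"
    by (blast intro: finite_subset[OF subset_UNIV])+
  have "X \<inter> Y = Y \<inter> X" for X Y :: "('a ^ 'n) set" by blast
  then show "symmetric ?G"
    by (auto simp only: symmetric_def sym_def grassmann_graph_def with_proj_simps
        pair_pre_digraph.simps mem_Collect_eq prod.case)
next
  let ?G = "with_proj (grassmann_graph k :: ('a ^ 'n) set pair_pre_digraph)"
  fix e assume "e \<in> arcs ?G"
  then have e: "fst e \<in> k_subspaces k" "snd e \<in> k_subspaces k" "vec.dim (fst e \<inter> snd e) + 1 = k"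
    by (simp_all only: grassmann_graph_def with_proj_simps pair_pre_digraph.simps
        mem_Collect_eq case_prod_beta)
  then show "tail ?G e \<in> verts ?G" "head ?G e \<in> verts ?G"
    by (simp_all only: grassmann_graph_def with_proj_simps pair_pre_digraph.simps)
  have "vec.dim (fst e) = k" using e(1) unfolding k_subspaces_def by blast
  with e(3) have "fst e \<noteq> snd e" by (metis Int_absorb n_not_Suc_n Suc_eq_plus1)
  then show "tail ?G e \<noteq> head ?G e" by simp
next
  let ?G = "with_proj (grassmann_graph k :: ('a ^ 'n) set pair_pre_digraph)"
  fix e e' assume "arc_to_ends ?G e = arc_to_ends ?G e'"
  then show "e = e'"
    by (simp add: arc_to_ends_def prod_eq_iff)
qed

(* The shortest-path distance with every arc of length 1; infinite between vertices of
   different components. *)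
definition graph_dist :: "('a, 'b) pre_digraph \<Rightarrow> 'a \<Rightarrow> 'a \<Rightarrow> ereal" where
  "graph_dist G u v = wf_digraph.\<mu> G (\<lambda>_. 1) u v"

definition resolving_set :: "('a, 'b) pre_digraph \<Rightarrow> 'a set \<Rightarrow> bool" where
  "resolving_set G S \<longleftrightarrow> finite S \<and> S \<subseteq> verts G \<and>
    (\<forall>u\<in>verts G. \<forall>w\<in>verts G. (\<forall>s\<in>S. graph_dist G u s = graph_dist G w s) \<longleftrightarrow> u = w)"

definition spread :: "nat \<Rightarrow> ('a::field ^ 'n) set set \<Rightarrow> bool" where
  "spread t \<S> \<longleftrightarrow> finite \<S> \<and> \<S> \<subseteq> k_subspaces t \<and>
    (\<forall>x. x \<noteq> 0 \<longrightarrow> (\<exists>!W. W \<in> \<S> \<and> x \<in> W)) \<and>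
    (\<forall>W\<in>\<S>. \<forall>W'\<in>\<S>. W \<noteq> W' \<longrightarrow> W \<inter> W' = {0})"

(* For k > n the factor with i = n vanishes, as it should. *)
definition gaussian_binomial :: "nat \<Rightarrow> nat \<Rightarrow> nat \<Rightarrow> real" where
  "gaussian_binomial q n k = (\<Prod>i<k. (real q ^ (n - i) - 1) / (real q ^ (i + 1) - 1))"

end

theory Submission
  imports Defs
begin

text \<open>
  Two \<open>k\<close>-subspaces \<open>u\<close> and \<open>w\<close> with the same distances to all members of \<open>\<M>\<close> satisfy
  \<open>dim (u \<inter> U) = dim (w \<inter> U)\<close> for every hyperplane \<open>U\<close> of every spread element \<open>W\<close>, because the
  distance in the Grassmann graph is \<open>k - dim (X \<inter> Y)\<close> (\<open>graph_dist_grassmann\<close>). Since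
  \<open>dim W = k + 1\<close>, both \<open>u \<inter> W\<close> and \<open>w \<inter> W\<close> are proper subspaces of \<open>W\<close>, and a proper subspace is
  determined by the dimensions of its intersections with hyperplanes: these dimensions reveal its
  own dimension and the hyperplanes containing it, and it is the intersection of the latter
  (\<open>subspace_eq_if_hyperplane_sections\<close>). Hence \<open>u\<close> and \<open>w\<close> meet each spread element in the same
  subspace; as the spread elements cover the space, \<open>u = w\<close>.

  For the cardinality, a space of dimension \<open>d\<close> over a field with \<open>q\<close> elements has \<open>q ^ d - 1\<close>
  nonzero linear forms. The kernel of each is a hyperplane, and each hyperplane is the kernel of
  \<open>q - 1\<close> of them, so there are \<open>(q ^ d - 1) / (q - 1)\<close> hyperplanes (\<open>card_hyperplanes\<close>). The nonzero
  vectors are partitioned by the spread into blocks of size \<open>q ^ (k + 1) - 1\<close> (\<open>card_spread\<close>), and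
  no \<open>k\<close>-subspace with \<open>k > 0\<close> lies in two spread elements. Multiplying the number of spread
  elements by the number of hyperplanes of each, the factor \<open>q ^ (k + 1) - 1\<close> cancels.
\<close>

section \<open>Hyperplanes of a subspace\<close>

text \<open>
  For \<open>x\<close> in \<open>W\<close> outside \<open>U\<close>, the next two lemmas together say that \<open>U\<close> is a hyperplane of \<open>W\<close>
  exactly when \<open>W\<close> is the sum of \<open>U\<close> and the line through \<open>x\<close>; \<open>a\<close> is the coordinate of \<open>y\<close> along \<open>x\<close>.
\<close>

lemma subspace_dim_insert:
  fixes U W :: "('a::field ^ 'n) set"
  assumes "vec.subspace U" "vec.subspace W" "U \<subseteq> W" "x \<in> W" "x \<notin> U"
    and decomp: "\<And>y. y \<in> W \<Longrightarrow> \<exists>a. y - a *s x \<in> U"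
  shows "vec.dim U + 1 = vec.dim W"
proof -
  have U: "vec.span U = U" using assms(1) by simp
  have "vec.span (insert x U) = W"
  proof
    show "vec.span (insert x U) \<subseteq> W" using assms by (intro vec.span_minimal) auto
    show "W \<subseteq> vec.span (insert x U)" using decomp by (auto simp: vec.span_insert U)
  qed
  then have "vec.dim W = vec.dim (insert x U)" by (metis vec.dim_span)
  then show ?thesis using \<open>x \<notin> U\<close> by (simp add: vec.dim_insert U)
qed

lemma hyperplane_decomposition:
  fixes U W :: "('a::field ^ 'n) set"
  assumes "vec.subspace U" "vec.subspace W" "U \<subseteq> W" "vec.dim U + 1 = vec.dim W"
    and "x \<in> W" "x \<notin> U" "y \<in> W"
  shows "\<exists>a. y - a *s x \<in> U"
proof -
  have U: "vec.span U = U" using assms(1) by simp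
  have "vec.dim (insert x U) = vec.dim W" using assms by (simp add: vec.dim_insert U)
  then have "vec.span (insert x U) = W"
    using assms vec.dim_eq_span[of "insert x U" W] by auto
  then show ?thesis using \<open>y \<in> W\<close> by (auto simp: vec.span_insert U)
qed

text \<open>
  Extend a basis of \<open>A\<close> first by \<open>x\<close> and then to a basis of \<open>W\<close>: all basis vectors other than \<open>x\<close>
  span a hyperplane with the required properties.
\<close>

lemma obtain_hyperplane_avoiding:
  fixes A W :: "('a::field ^ 'n) set"
  assumes A: "vec.subspace A" and W: "vec.subspace W" and "A \<subseteq> W" "x \<in> W" "x \<notin> A"
  obtains U where "vec.subspace U" "A \<subseteq> U" "U \<subseteq> W" "x \<notin> U" "vec.dim U + 1 = vec.dim W"
proof -
  obtain B where B: "B \<subseteq> A" "vec.independent B" "A \<subseteq> vec.span B"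
    by (meson vec.basis_exists)
  have spanB: "vec.span B = A" using B A by (simp add: vec.span_subspace)
  with \<open>x \<notin> A\<close> have "x \<notin> B" "vec.independent (insert x B)"
    using B by (auto simp: vec.independent_insert vec.span_base)
  then obtain C where C: "insert x B \<subseteq> C" "C \<subseteq> W" "vec.independent C" "W \<subseteq> vec.span C"
    using vec.maximal_independent_subset_extend[of "insert x B" W] B assms by blast
  let ?U = "vec.span (C - {x})"
  show thesis
  proof
    show "vec.subspace ?U" by simp
    show "A \<subseteq> ?U" using C \<open>x \<notin> B\<close> by (subst spanB[symmetric], intro vec.span_mono) auto
    show "?U \<subseteq> W" using C W by (intro vec.span_minimal) auto
    show "x \<notin> ?U" using C by (auto simp: vec.dependent_def)
    have "finite C" using C(3) vec.finiteI_independent by blast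
    moreover have "vec.dim W = card C" using C vec.dim_unique by blast
    moreover have "vec.dim ?U = card (C - {x})"
      using C by (simp add: vec.dim_eq_card_independent vec.independent_mono)
    moreover have "x \<in> C" using C by auto
    ultimately show "vec.dim ?U + 1 = vec.dim W"
      by (metis Suc_eq_plus1 card.remove)
  qed
qed

section \<open>Distances in the Grassmann graph\<close>

lemma dim_Int_ge:
  fixes A B W :: "('a::field ^ 'n) set"
  assumes "vec.subspace A" "vec.subspace B" "vec.subspace W" "A \<subseteq> W" "B \<subseteq> W"
  shows "vec.dim A + vec.dim B \<le> vec.dim (A \<inter> B) + vec.dim W"
proof -
  have "{x + y |x y. x \<in> A \<and> y \<in> B} \<subseteq> W"
    using assms by (auto intro: vec.subspace_add)
  from vec.dim_subset[OF this] vec.dim_sums_Int[of A B] assms show ?thesis by simp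
qed

context
  fixes k :: nat and G :: "(('a::{field,finite} ^ 'n) set, ('a ^ 'n) set \<times> ('a ^ 'n) set) pre_digraph"
  defines "G \<equiv> with_proj (grassmann_graph k)"
begin

interpretation graph G
  unfolding G_def by (rule graph_grassmann_graph)

lemma grassmann_arc_iff:
  "(X, Y) \<in> arcs G \<longleftrightarrow> X \<in> k_subspaces k \<and> Y \<in> k_subspaces k \<and> vec.dim (X \<inter> Y) + 1 = k"
  by (simp add: G_def grassmann_graph_def)

lemma grassmann_verts: "verts G = k_subspaces k"
  by (simp add: G_def grassmann_graph_def)

lemma grassmann_ends: "tail G e = fst e" "head G e = snd e"
  by (simp_all add: G_def)

text \<open>
  One step of a walk changes the dimension of the intersection with \<open>v\<close> by at most one: if \<open>u\<close> is
  adjacent to \<open>w\<close>, then \<open>u \<inter> w\<close> is a hyperplane of \<open>w\<close>, so it meets \<open>w \<inter> v\<close> in codimension at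
  most one.
\<close>

lemma grassmann_walk_length_ge:
  assumes "awalk u p v"
  shows "k \<le> vec.dim (u \<inter> v) + length p"
  using assms
proof (induction p arbitrary: u)
  case Nil
  then show ?case by (auto simp: awalk_Nil_iff grassmann_verts k_subspaces_def)
next
  case (Cons e p)
  obtain w where e: "e = (u, w)" and arc: "(u, w) \<in> arcs G" and walk: "awalk w p v"
    using Cons.prems by (cases e) (auto simp: awalk_Cons_iff grassmann_ends)
  have sub: "vec.subspace u" "vec.subspace w" "vec.subspace v"
    and dims: "vec.dim w = k" "vec.dim (u \<inter> w) + 1 = k"
    using arc awalk_last_in_verts[OF walk]
    by (auto simp: grassmann_arc_iff k_subspaces_def awalk_def grassmann_verts)
  have "vec.dim (u \<inter> w) + vec.dim (w \<inter> v) \<le> vec.dim ((u \<inter> w) \<inter> (w \<inter> v)) + vec.dim w"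
    using sub by (intro dim_Int_ge) (auto intro: vec.subspace_inter)
  also have "vec.dim ((u \<inter> w) \<inter> (w \<inter> v)) \<le> vec.dim (u \<inter> v)"
    by (intro vec.dim_subset) auto
  finally show ?case using Cons.IH[OF walk] dims by simp
qed

text \<open>
  As long as \<open>u \<noteq> v\<close>, a neighbour of \<open>u\<close> has a larger intersection with \<open>v\<close>: keep a hyperplane of
  \<open>u\<close> that contains \<open>u \<inter> v\<close>, and add a vector of \<open>v\<close> outside \<open>u\<close>.
\<close>

lemma grassmann_short_walk:
  assumes "u \<in> k_subspaces k" "v \<in> k_subspaces k" "k \<le> vec.dim (u \<inter> v) + j"
  shows "\<exists>p. awalk u p v \<and> length p \<le> j"
  using assms
proof (induction j arbitrary: u)
  case 0
  then have sub: "vec.subspace u" "vec.subspace v" "vec.dim u = k" "vec.dim v = k"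
    by (auto simp: k_subspaces_def)
  have "u \<inter> v = u" "u \<inter> v = v"
    using 0 sub by (intro vec.subspace_dim_equal vec.subspace_inter; simp)+
  then have "u = v" by simp
  with 0 show ?case by (auto simp: awalk_Nil_iff grassmann_verts)
next
  case (Suc j)
  have sub: "vec.subspace u" "vec.subspace v" and dims: "vec.dim u = k" "vec.dim v = k"
    using Suc.prems by (auto simp: k_subspaces_def)
  show ?case
  proof (cases "u = v")
    case True
    with Suc.prems have "awalk u [] v" by (simp add: awalk_Nil_iff grassmann_verts)
    then show ?thesis by force
  next
    case False
    then have "\<not> u \<subseteq> v" "\<not> v \<subseteq> u"
      using vec.subspace_dim_equal[of u v] vec.subspace_dim_equal[of v u] sub dims by auto
    then obtain x y where x: "x \<in> v" "x \<notin> u" and y: "y \<in> u" "y \<notin> v"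
      by blast
    \<comment> \<open>The vector \<open>y\<close> shows that \<open>u \<inter> v\<close> is a proper subspace of \<open>u\<close>, as a hyperplane
        containing it requires.\<close>
    obtain U where U: "vec.subspace U" "u \<inter> v \<subseteq> U" "U \<subseteq> u" "y \<notin> U" "vec.dim U + 1 = k"
      using obtain_hyperplane_avoiding[of "u \<inter> v" u y] sub dims y
      by (metis IntE inf_le1 vec.subspace_inter)
    let ?w = "vec.span (insert x U)"
    have spanU: "vec.span U = U" using U by simp
    have "x \<notin> U" using U x by auto
    have w: "vec.subspace ?w" by simp
    have dimw: "vec.dim ?w = k" using U \<open>x \<notin> U\<close> by (simp add: vec.dim_insert spanU)
    have xw: "x \<in> ?w" by (simp add: vec.span_base)
    have Uw: "U \<subseteq> ?w" using vec.span_superset by blast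
    have "vec.dim (u \<inter> ?w) < k"
    proof (rule ccontr)
      assume "\<not> vec.dim (u \<inter> ?w) < k"
      then have "u \<inter> ?w = ?w"
        using sub w dimw by (intro vec.subspace_dim_equal vec.subspace_inter) auto
      with x xw show False by auto
    qed
    moreover have "vec.dim U \<le> vec.dim (u \<inter> ?w)" using U Uw by (intro vec.dim_subset) auto
    ultimately have "vec.dim (u \<inter> ?w) + 1 = k" using U by simp
    with w dimw Suc.prems have arc: "(u, ?w) \<in> arcs G" and wk: "?w \<in> k_subspaces k"
      by (auto simp: grassmann_arc_iff k_subspaces_def)
    have "insert x (u \<inter> v) \<subseteq> ?w \<inter> v" using U Uw x xw by auto
    moreover have "x \<notin> vec.span (u \<inter> v)"
      using vec.span_minimal[OF Int_lower1 sub(1)] x(2) by blast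
    ultimately have "vec.dim (u \<inter> v) + 1 \<le> vec.dim (?w \<inter> v)"
      using vec.dim_subset[of "insert x (u \<inter> v)" "?w \<inter> v"] by (simp add: vec.dim_insert)
    then obtain p where "awalk ?w p v" "length p \<le> j"
      using Suc.IH[OF wk] Suc.prems by auto
    then have "awalk u ((u, ?w) # p) v" "length ((u, ?w) # p) \<le> Suc j"
      using arc Suc.prems by (auto simp: awalk_Cons_iff grassmann_ends)
    then show ?thesis by blast
  qed
qed

lemma graph_dist_grassmann:
  assumes "u \<in> k_subspaces k" "v \<in> k_subspaces k"
  shows "graph_dist G u v = ereal (real (k - vec.dim (u \<inter> v)))"
proof -
  have cost: "awalk_cost (\<lambda>_. 1) p = real (length p)" for p :: "(('a ^ 'n) set \<times> ('a ^ 'n) set) list"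
    by (induction p) auto
  have "k \<le> vec.dim (u \<inter> v) + (k - vec.dim (u \<inter> v))" by simp
  from grassmann_short_walk[OF assms this]
  obtain p where "awalk u p v" "length p \<le> k - vec.dim (u \<inter> v)" by blast
  then have p: "p \<in> {p. awalk u p v}" "ereal (real (length p)) \<le> ereal (real (k - vec.dim (u \<inter> v)))"
    by simp_all
  have lower: "ereal (real (k - vec.dim (u \<inter> v))) \<le> ereal (real (length p'))"
    if "p' \<in> {p. awalk u p v}" for p'
  proof -
    have "awalk u p' v" using that by simp
    from grassmann_walk_length_ge[OF this] show ?thesis by simp
  qed
  show ?thesis
    unfolding graph_dist_def \<mu>_def cost
  proof (rule antisym)
    show "(INF p\<in>{p. awalk u p v}. ereal (real (length p))) \<le> ereal (real (k - vec.dim (u \<inter> v)))"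
      using p by (rule INF_lower2)
    show "ereal (real (k - vec.dim (u \<inter> v))) \<le> (INF p\<in>{p. awalk u p v}. ereal (real (length p)))"
      using lower by (rule INF_greatest)
  qed
qed

end

section \<open>Hyperplane sections determine a subspace\<close>

text \<open>
  A hyperplane \<open>U\<close> containing \<open>T\<close> exists since \<open>T\<close> is proper, and it gives
  \<open>dim T = dim (S \<inter> U) \<le> dim S\<close>. For \<open>T = W\<close> this breaks down: any hyperplane of a \<open>W\<close> of
  dimension one meets both \<open>W\<close> and \<open>{0}\<close> in \<open>{0}\<close>.
\<close>

lemma hyperplane_sections_dim_le:
  fixes S T W :: "('a::field ^ 'n) set"
  assumes "vec.subspace T" "vec.subspace W" "T \<subset> W"
    and sections: "\<And>U. \<lbrakk>vec.subspace U; U \<subseteq> W; vec.dim U + 1 = vec.dim W\<rbrakk>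
      \<Longrightarrow> vec.dim (S \<inter> U) = vec.dim (T \<inter> U)"
  shows "vec.dim T \<le> vec.dim S"
proof -
  obtain x where x: "x \<in> W" "x \<notin> T" using assms(3) by auto
  obtain U where U: "vec.subspace U" "T \<subseteq> U" "U \<subseteq> W" "vec.dim U + 1 = vec.dim W"
    by (rule obtain_hyperplane_avoiding[OF assms(1,2) psubset_imp_subset[OF assms(3)] x])
  have "vec.dim T = vec.dim (S \<inter> U)" using sections[OF U(1,3,4)] U(2) by (simp add: Int_absorb2)
  then show ?thesis using vec.dim_subset[of "S \<inter> U" S] by simp
qed

text \<open>
  Since \<open>dim T \<le> dim S\<close>, every hyperplane \<open>U\<close> containing \<open>S\<close> also contains \<open>T\<close>, for
  \<open>dim (T \<inter> U) = dim S\<close>. So \<open>T\<close> lies in the intersection of these hyperplanes, which is \<open>S\<close>.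
\<close>

lemma hyperplane_sections_subset:
  fixes S T W :: "('a::field ^ 'n) set"
  assumes "vec.subspace S" "vec.subspace T" "vec.subspace W" "S \<subseteq> W" "T \<subseteq> W"
    and dims: "vec.dim T \<le> vec.dim S"
    and sections: "\<And>U. \<lbrakk>vec.subspace U; U \<subseteq> W; vec.dim U + 1 = vec.dim W\<rbrakk>
      \<Longrightarrow> vec.dim (S \<inter> U) = vec.dim (T \<inter> U)"
  shows "T \<subseteq> S"
proof
  fix x assume x: "x \<in> T"
  show "x \<in> S"
  proof (rule ccontr)
    assume "x \<notin> S"
    obtain U where U: "vec.subspace U" "S \<subseteq> U" "U \<subseteq> W" "x \<notin> U" "vec.dim U + 1 = vec.dim W"
      by (rule obtain_hyperplane_avoiding[OF assms(1,3,4) subsetD[OF assms(5) x] \<open>x \<notin> S\<close>])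
    have "vec.dim S = vec.dim (T \<inter> U)"
      using sections[OF U(1,3,5)] U(2) by (simp add: Int_absorb2)
    then have "T \<inter> U = T"
      using assms(2) U(1) dims by (intro vec.subspace_dim_equal vec.subspace_inter) simp_all
    with x U(4) show False by auto
  qed
qed

lemma subspace_eq_if_hyperplane_sections:
  fixes A B W :: "('a::field ^ 'n) set"
  assumes "vec.subspace A" "vec.subspace B" "vec.subspace W" "A \<subset> W" "B \<subset> W"
    and sections: "\<And>U. \<lbrakk>vec.subspace U; U \<subseteq> W; vec.dim U + 1 = vec.dim W\<rbrakk>
      \<Longrightarrow> vec.dim (A \<inter> U) = vec.dim (B \<inter> U)"
  shows "A = B"
proof
  have "vec.dim B \<le> vec.dim A"
    by (rule hyperplane_sections_dim_le[OF assms(2,3,5) sections])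
  moreover have "vec.dim A \<le> vec.dim B"
    by (rule hyperplane_sections_dim_le[OF assms(1,3,4) sections[symmetric]])
  ultimately show "A \<subseteq> B" "B \<subseteq> A"
    using hyperplane_sections_subset[OF assms(1-3) psubset_imp_subset[OF assms(4)]
        psubset_imp_subset[OF assms(5)] _ sections]
      hyperplane_sections_subset[OF assms(2,1,3) psubset_imp_subset[OF assms(5)]
        psubset_imp_subset[OF assms(4)] _ sections[symmetric]]
    by blast+
qed

section \<open>Counting points and hyperplanes\<close>

text \<open>
  The coordinates with respect to a basis identify \<open>W\<close> with the functions from the basis to the
  field.
\<close>

lemma card_subspace:
  fixes W :: "('a::{field,finite} ^ 'n) set"
  assumes "vec.subspace W"
  shows "card W = CARD('a) ^ vec.dim W"
proof -
  obtain C where C: "C \<subseteq> W" "vec.independent C" "W \<subseteq> vec.span C" "card C = vec.dim W"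
    by (meson vec.basis_exists)
  have fin: "finite C" by simp
  have WC: "vec.span C = W" using C assms by (simp add: vec.span_subspace)
  have "bij_betw (\<lambda>c. \<Sum>b\<in>C. c b *s b) (C \<rightarrow>\<^sub>E (UNIV::'a set)) W"
  proof (rule bij_betw_imageI)
    show "inj_on (\<lambda>c. \<Sum>b\<in>C. c b *s b) (C \<rightarrow>\<^sub>E (UNIV::'a set))"
    proof (rule inj_onI)
      fix c c' :: "'a ^ 'n \<Rightarrow> 'a"
      assume cc: "c \<in> C \<rightarrow>\<^sub>E UNIV" "c' \<in> C \<rightarrow>\<^sub>E UNIV" "(\<Sum>b\<in>C. c b *s b) = (\<Sum>b\<in>C. c' b *s b)"
      then have "(\<Sum>b\<in>C. (c b - c' b) *s b) = 0"
        by (simp add: vec.scale_left_diff_distrib sum_subtractf)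
      then have "c b = c' b" if "b \<in> C" for b
        using C(2) that by (auto simp: vec.independent_explicit dest: spec[where x="\<lambda>b. c b - c' b"])
      then show "c = c'" using cc by (auto intro: PiE_ext)
    qed
    show "(\<lambda>c. \<Sum>b\<in>C. c b *s b) ` (C \<rightarrow>\<^sub>E (UNIV::'a set)) = W"
    proof
      show "(\<lambda>c. \<Sum>b\<in>C. c b *s b) ` (C \<rightarrow>\<^sub>E (UNIV::'a set)) \<subseteq> W"
        using C assms by (auto intro!: vec.subspace_sum vec.subspace_scale)
      show "W \<subseteq> (\<lambda>c. \<Sum>b\<in>C. c b *s b) ` (C \<rightarrow>\<^sub>E (UNIV::'a set))"
      proof
        fix x assume "x \<in> W"
        then have "(\<Sum>b\<in>C. vec.representation C x b *s b) = x"
          using C fin by (intro vec.sum_representation_eq) auto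
        then show "x \<in> (\<lambda>c. \<Sum>b\<in>C. c b *s b) ` (C \<rightarrow>\<^sub>E (UNIV::'a set))"
          by (intro image_eqI[of _ _ "restrict (vec.representation C x) C"]) auto
      qed
    qed
  qed
  then have "card W = card (C \<rightarrow>\<^sub>E (UNIV::'a set))" by (simp add: bij_betw_same_card)
  also have "\<dots> = CARD('a) ^ card C" by (simp add: card_PiE)
  finally show ?thesis using C by simp
qed

text \<open>
  Forms are only linear on \<open>W\<close>; requiring them to be undefined outside \<open>W\<close> makes equality of forms
  mean equality on \<open>W\<close>, so that they can be counted.
\<close>

definition linear_forms :: "('a::field ^ 'n) set \<Rightarrow> ('a ^ 'n \<Rightarrow> 'a) set" where
  "linear_forms W = {f \<in> extensional W.
    (\<forall>x\<in>W. \<forall>y\<in>W. f (x + y) = f x + f y) \<and> (\<forall>a. \<forall>x\<in>W. f (a *s x) = a * f x)}"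

definition form_kernel :: "('a::field ^ 'n) set \<Rightarrow> ('a ^ 'n \<Rightarrow> 'a) \<Rightarrow> ('a ^ 'n) set" where
  "form_kernel W f = {x \<in> W. f x = 0}"

lemma linear_forms_diff_scale:
  assumes "f \<in> linear_forms W" "vec.subspace W" "x \<in> W" "y \<in> W"
  shows "f (x - a *s y) = f x - a * f y"
proof -
  have mem: "x - a *s y \<in> W" "a *s y \<in> W"
    using assms by (auto intro: vec.subspace_diff vec.subspace_scale)
  have "f ((x - a *s y) + a *s y) = f (x - a *s y) + f (a *s y)"
    using mem assms(1) unfolding linear_forms_def by blast
  moreover have "f (a *s y) = a * f y"
    using assms(1,4) unfolding linear_forms_def by blast
  ultimately show ?thesis by simp
qed

text \<open>A linear form is determined by its values on a basis, which can be prescribed freely.\<close>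

lemma card_linear_forms:
  fixes W :: "('a::{field,finite} ^ 'n) set"
  assumes W: "vec.subspace W"
  shows "card (linear_forms W) = CARD('a) ^ vec.dim W"
proof -
  obtain C where C: "C \<subseteq> W" "vec.independent C" "W \<subseteq> vec.span C" "card C = vec.dim W"
    by (meson vec.basis_exists)
  have WC: "vec.span C = W" using C W by (simp add: vec.span_subspace)
  have "bij_betw (\<lambda>f. restrict f C) (linear_forms W) (C \<rightarrow>\<^sub>E UNIV)"
  proof (rule bij_betw_imageI)
    show "inj_on (\<lambda>f. restrict f C) (linear_forms W)"
    proof (rule inj_onI)
      fix f g assume f: "f \<in> linear_forms W" and g: "g \<in> linear_forms W"
        and eq: "restrict f C = restrict g C"
      have on_C: "f b = g b" if "b \<in> C" for b using fun_cong[OF eq, of b] that by simp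
      have zero: "f 0 = 0" "g 0 = 0"
        using linear_forms_diff_scale[OF f W, of 0 0 1] linear_forms_diff_scale[OF g W, of 0 0 1]
          vec.subspace_0[OF W] by simp_all
      have "vec.subspace {x \<in> W. f x = g x}"
        using f g W zero unfolding vec.subspace_def linear_forms_def by auto
      then have "vec.span C \<subseteq> {x \<in> W. f x = g x}"
        using on_C C(1) by (intro vec.span_minimal) auto
      then have "f x = g x" if "x \<in> W" for x using WC that by blast
      moreover have "f \<in> extensional W" "g \<in> extensional W"
        using f g by (simp_all add: linear_forms_def)
      ultimately show "f = g" by (intro extensionalityI[of f W g])
    qed
    show "(\<lambda>f. restrict f C) ` linear_forms W = C \<rightarrow>\<^sub>E UNIV"
    proof (intro equalityI subsetI)
      fix c assume "c \<in> (\<lambda>f. restrict f C) ` linear_forms W"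
      then show "c \<in> C \<rightarrow>\<^sub>E UNIV" by auto
    next
      fix c :: "'a ^ 'n \<Rightarrow> 'a" assume c: "c \<in> C \<rightarrow>\<^sub>E UNIV"
      let ?f = "\<lambda>x\<in>W. \<Sum>b\<in>C. c b * vec.representation C x b"
      have form: "?f \<in> linear_forms W"
        using C(2) vec.subspace_add[OF W] vec.subspace_scale[OF W]
        by (simp add: linear_forms_def vec.representation_add vec.representation_scale WC
            distrib_left sum.distrib sum_distrib_left mult.left_commute)
      have "restrict ?f C = c"
      proof (rule extensionalityI[of _ C])
        fix b assume b: "b \<in> C"
        then have "?f b = (\<Sum>v\<in>C. c v * (if v = b then 1 else 0))"
          using C by (auto simp: vec.representation_basis)
        also have "\<dots> = (\<Sum>v\<in>C. if v = b then c v else 0)" by (intro sum.cong) auto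
        finally show "restrict ?f C b = c b" using b by simp
      qed (use c in \<open>auto simp: PiE_def\<close>)
      then show "c \<in> (\<lambda>f. restrict f C) ` linear_forms W"
        using form by (intro image_eqI[of c _ ?f]) (rule sym)
    qed
  qed
  then have "card (linear_forms W) = card (C \<rightarrow>\<^sub>E (UNIV :: 'a set))"
    by (simp add: bij_betw_same_card)
  also have "\<dots> = CARD('a) ^ vec.dim W" using C by (simp add: card_PiE)
  finally show ?thesis .
qed

lemma form_kernel_hyperplane:
  assumes W: "vec.subspace W" and f: "f \<in> linear_forms W" and x: "x \<in> W" "f x \<noteq> 0"
  shows "vec.subspace (form_kernel W f)" "vec.dim (form_kernel W f) + 1 = vec.dim W"
proof -
  have zero: "f 0 = 0"
    using linear_forms_diff_scale[OF f W, of 0 0 1] vec.subspace_0[OF W] by simp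
  then show K: "vec.subspace (form_kernel W f)"
    using f W unfolding vec.subspace_def linear_forms_def form_kernel_def by auto
  show "vec.dim (form_kernel W f) + 1 = vec.dim W"
  proof (rule subspace_dim_insert[OF K W _ x(1)])
    show "form_kernel W f \<subseteq> W" "x \<notin> form_kernel W f"
      using x by (auto simp: form_kernel_def)
    fix y assume y: "y \<in> W"
    have "y - (f y / f x) *s x \<in> W"
      using x y W by (intro vec.subspace_diff vec.subspace_scale)
    then have "y - (f y / f x) *s x \<in> form_kernel W f"
      using linear_forms_diff_scale[OF f W y x(1)] x(2) by (simp add: form_kernel_def)
    then show "\<exists>a. y - a *s x \<in> form_kernel W f" by blast
  qed
qed

text \<open>
  Fix \<open>x\<close> in \<open>W\<close> outside \<open>U\<close>, and let \<open>g\<close> be the coordinate along \<open>x\<close> modulo \<open>U\<close>. It is a form with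
  kernel \<open>U\<close>, and any other such form \<open>f\<close> is the multiple \<open>f x * g\<close>. Hence \<open>f \<mapsto> f x\<close> is a bijection
  from these forms to the nonzero scalars.
\<close>

lemma card_forms_with_kernel:
  fixes W :: "('a::{field,finite} ^ 'n) set"
  assumes W: "vec.subspace W" and U: "vec.subspace U" "U \<subseteq> W" "vec.dim U + 1 = vec.dim W"
  shows "card {f \<in> linear_forms W. form_kernel W f = U} = CARD('a) - 1"
proof -
  have "U \<noteq> W" using U by auto
  then obtain x where x: "x \<in> W" "x \<notin> U" using U by auto
  define g where "g y = (SOME a. y - a *s x \<in> U)" for y
  have g: "y - g y *s x \<in> U" if "y \<in> W" for y
    unfolding g_def
    by (rule someI_ex) (rule hyperplane_decomposition[OF U(1) W U(2,3) x that])
  have g_eq: "g y = a" if y: "y \<in> W" and a: "y - a *s x \<in> U" for y a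
  proof (rule ccontr)
    assume ne: "g y \<noteq> a"
    have "(y - a *s x) - (y - g y *s x) \<in> U"
      using vec.subspace_diff[OF U(1) a g[OF y]] .
    then have "(g y - a) *s x \<in> U" by (simp add: vec.scale_left_diff_distrib)
    then have "inverse (g y - a) *s ((g y - a) *s x) \<in> U"
      by (rule vec.subspace_scale[OF U(1)])
    with ne x show False by simp
  qed
  have g_add: "g (y + z) = g y + g z" if "y \<in> W" "z \<in> W" for y z
  proof (rule g_eq)
    show "y + z \<in> W" using that W by (intro vec.subspace_add)
    have "(y - g y *s x) + (z - g z *s x) \<in> U"
      using vec.subspace_add[OF U(1) g[OF that(1)] g[OF that(2)]] .
    then show "y + z - (g y + g z) *s x \<in> U"
      by (simp add: vec.scale_left_distrib algebra_simps)
  qed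
  have g_scale: "g (a *s y) = a * g y" if "y \<in> W" for a y
  proof (rule g_eq)
    show "a *s y \<in> W" using that W by (intro vec.subspace_scale)
    have "a *s (y - g y *s x) \<in> U"
      using vec.subspace_scale[OF U(1) g[OF that]] .
    then show "a *s y - (a * g y) *s x \<in> U" by (simp add: vec.scale_right_diff_distrib)
  qed
  have g_zero: "g y = 0 \<longleftrightarrow> y \<in> U" if "y \<in> W" for y
    using g[OF that] g_eq[OF that, of 0] by auto
  have g_x: "g x = 1" using g_eq[OF x(1), of 1] vec.subspace_0[OF U(1)] by simp
  have "bij_betw (\<lambda>f. f x) {f \<in> linear_forms W. form_kernel W f = U} (UNIV - {0})"
  proof (rule bij_betw_imageI)
    have multiple: "f y = g y * f x"
      if f: "f \<in> linear_forms W" "form_kernel W f = U" and y: "y \<in> W" for f y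
    proof -
      have "f (y - g y *s x) = 0" using g[OF y] f(2) by (auto simp: form_kernel_def)
      then show ?thesis using linear_forms_diff_scale[OF f(1) W y x(1)] by simp
    qed
    show "inj_on (\<lambda>f. f x) {f \<in> linear_forms W. form_kernel W f = U}"
    proof (rule inj_onI)
      fix f h assume f: "f \<in> {f \<in> linear_forms W. form_kernel W f = U}"
        and h: "h \<in> {f \<in> linear_forms W. form_kernel W f = U}" and eq: "f x = h x"
      have "f y = h y" if "y \<in> W" for y
        using multiple[of f y] multiple[of h y] f h eq that by simp
      moreover have "f \<in> extensional W" "h \<in> extensional W"
        using f h by (simp_all add: linear_forms_def)
      ultimately show "f = h" by (intro extensionalityI[of f W h])
    qed
    show "(\<lambda>f. f x) ` {f \<in> linear_forms W. form_kernel W f = U} = UNIV - {0}"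
    proof (intro equalityI subsetI)
      fix a assume "a \<in> (\<lambda>f. f x) ` {f \<in> linear_forms W. form_kernel W f = U}"
      then show "a \<in> UNIV - {0}" using x by (auto simp: form_kernel_def)
    next
      fix a :: 'a assume a: "a \<in> UNIV - {0}"
      let ?f = "\<lambda>y\<in>W. a * g y"
      have "?f \<in> linear_forms W"
        using vec.subspace_add[OF W] vec.subspace_scale[OF W]
        by (simp add: linear_forms_def g_add g_scale distrib_left mult.left_commute)
      moreover have "form_kernel W ?f = U"
        using a U(2) g_zero by (auto simp: form_kernel_def)
      moreover have "?f x = a" using x g_x by simp
      ultimately show "a \<in> (\<lambda>f. f x) ` {f \<in> linear_forms W. form_kernel W f = U}"
        by (metis (mono_tags, lifting) imageI mem_Collect_eq)
    qed
  qed
  then have "card {f \<in> linear_forms W. form_kernel W f = U} = card (UNIV - {0 :: 'a})"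
    by (rule bij_betw_same_card)
  then show ?thesis by simp
qed

lemma card_hyperplanes:
  fixes W :: "('a::{field,finite} ^ 'n) set"
  assumes W: "vec.subspace W"
  shows "card {U. vec.subspace U \<and> U \<subseteq> W \<and> vec.dim U + 1 = vec.dim W} * (CARD('a) - 1)
    = CARD('a) ^ vec.dim W - 1"
proof -
  let ?H = "{U. vec.subspace U \<and> U \<subseteq> W \<and> vec.dim U + 1 = vec.dim W}"
  let ?fib = "\<lambda>U. {f \<in> linear_forms W. form_kernel W f = U}"
  let ?zero = "\<lambda>x\<in>W. 0 :: 'a"
  have "linear_forms W \<subseteq> W \<rightarrow>\<^sub>E (UNIV :: 'a set)"
    by (auto simp: linear_forms_def PiE_def)
  then have fin: "finite (linear_forms W)"
    by (rule finite_subset) (simp add: finite_PiE)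
  have zero: "?zero \<in> linear_forms W"
    using vec.subspace_add[OF W] vec.subspace_scale[OF W] by (simp add: linear_forms_def)
  \<comment> \<open>The zero form is excluded since its kernel is \<open>W\<close>, which is no hyperplane.\<close>
  have "linear_forms W - {?zero} = (\<Union>U\<in>?H. ?fib U)"
  proof (intro equalityI subsetI)
    fix f assume f: "f \<in> linear_forms W - {?zero}"
    have "\<exists>x\<in>W. f x \<noteq> 0"
    proof (rule ccontr)
      assume "\<not> (\<exists>x\<in>W. f x \<noteq> 0)"
      then have "f = ?zero"
        using f by (intro extensionalityI[of f W]) (auto simp: linear_forms_def)
      with f show False by simp
    qed
    then have "form_kernel W f \<in> ?H"
      using form_kernel_hyperplane[OF W] f by (auto simp: form_kernel_def)
    then show "f \<in> (\<Union>U\<in>?H. ?fib U)" using f by blast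
  next
    fix f assume f: "f \<in> (\<Union>U\<in>?H. ?fib U)"
    have "form_kernel W ?zero = W" by (auto simp: form_kernel_def)
    with f show "f \<in> linear_forms W - {?zero}" by auto
  qed
  moreover have "card (\<Union>U\<in>?H. ?fib U) = (\<Sum>U\<in>?H. card (?fib U))"
    using fin by (intro card_UN_disjoint) auto
  moreover have "(\<Sum>U\<in>?H. card (?fib U)) = card ?H * (CARD('a) - 1)"
    using card_forms_with_kernel[OF W] by simp
  moreover have "card (linear_forms W - {?zero}) = CARD('a) ^ vec.dim W - 1"
    using card_linear_forms[OF W] zero fin by (simp add: card_Diff_singleton)
  ultimately show ?thesis by simp
qed

section \<open>Hyperplanes of the elements of a spread\<close>

lemma spread_finite: "spread t \<S> \<Longrightarrow> finite \<S>"
  unfolding spread_def by (elim conjE)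

lemma spread_member:
  assumes "spread t \<S>" "W \<in> \<S>"
  shows "vec.subspace W" "vec.dim W = t"
proof -
  have "\<S> \<subseteq> k_subspaces t" using assms(1) unfolding spread_def by (elim conjE)
  then have "W \<in> k_subspaces t" using assms(2) by (rule subsetD)
  then show "vec.subspace W" "vec.dim W = t" by (simp_all add: k_subspaces_def)
qed

lemma spread_cover:
  assumes "spread t \<S>" "x \<noteq> 0"
  obtains W where "W \<in> \<S>" "x \<in> W"
proof -
  have "\<forall>x. x \<noteq> 0 \<longrightarrow> (\<exists>!W. W \<in> \<S> \<and> x \<in> W)"
    using assms(1) unfolding spread_def by (elim conjE)
  then have "\<exists>!W. W \<in> \<S> \<and> x \<in> W" using assms(2) by simp
  then show thesis using that by (elim ex1E conjE)
qed

lemma spread_Int: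
  assumes "spread t \<S>" "W \<in> \<S>" "W' \<in> \<S>" "W \<noteq> W'"
  shows "W \<inter> W' = {0}"
proof -
  have "\<forall>W\<in>\<S>. \<forall>W'\<in>\<S>. W \<noteq> W' \<longrightarrow> W \<inter> W' = {0}"
    using assms(1) unfolding spread_def by (elim conjE)
  then show ?thesis using assms(2-4) by simp
qed

lemma card_spread:
  fixes \<S> :: "('a::{field,finite} ^ 'n) set set"
  assumes "spread t \<S>"
  shows "card \<S> * (CARD('a) ^ t - 1) = CARD('a) ^ CARD('n) - 1"
proof -
  note sub = spread_member[OF assms]
  have card: "card (W - {0}) = CARD('a) ^ t - 1" if "W \<in> \<S>" for W
    using sub[OF that] card_subspace[of W] vec.subspace_0[of W] by simp
  have "UNIV - {0} = (\<Union>W\<in>\<S>. W - {0})" by (auto elim: spread_cover[OF assms])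
  then have "CARD('a ^ 'n) - 1 = card (\<Union>W\<in>\<S>. W - {0})"
    by (metis card_Diff_singleton UNIV_I)
  also have "\<dots> = (\<Sum>W\<in>\<S>. card (W - {0}))"
  proof (rule card_UN_disjoint)
    show "\<forall>W\<in>\<S>. \<forall>W'\<in>\<S>. W \<noteq> W' \<longrightarrow> (W - {0}) \<inter> (W' - {0}) = {}"
      using spread_Int[OF assms] by blast
  qed (simp_all add: spread_finite[OF assms])
  also have "\<dots> = card \<S> * (CARD('a) ^ t - 1)" using card by simp
  finally show ?thesis by simp
qed

lemma card_spread_hyperplanes:
  fixes \<S> :: "('a::{field,finite} ^ 'n) set set"
  assumes "spread (k + 1) \<S>" "0 < k"
  shows "card (\<Union>W\<in>\<S>. {U. vec.subspace U \<and> U \<subseteq> W \<and> vec.dim U = k}) * (CARD('a) - 1)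
    = CARD('a) ^ CARD('n) - 1"
proof -
  let ?H = "\<lambda>W. {U. vec.subspace U \<and> U \<subseteq> W \<and> vec.dim U = k}"
  note sub = spread_member[OF assms(1)]
  \<comment> \<open>A common hyperplane of two spread elements would be contained in \<open>{0}\<close>.\<close>
  have disj: "?H W \<inter> ?H W' = {}" if "W \<in> \<S>" "W' \<in> \<S>" "W \<noteq> W'" for W W'
  proof -
    have "W \<inter> W' = {0}" by (rule spread_Int[OF assms(1) that])
    then have "vec.dim U = 0" if "U \<subseteq> W" "U \<subseteq> W'" for U
      using that by (metis Int_greatest vec.dim_eq_0)
    with \<open>0 < k\<close> show ?thesis by fastforce
  qed
  have "card (\<Union>W\<in>\<S>. ?H W) = (\<Sum>W\<in>\<S>. card (?H W))"
    using disj spread_finite[OF assms(1)] by (intro card_UN_disjoint) simp_all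
  then have "card (\<Union>W\<in>\<S>. ?H W) * (CARD('a) - 1) = (\<Sum>W\<in>\<S>. card (?H W) * (CARD('a) - 1))"
    by (simp add: sum_distrib_right)
  also have "\<dots> = (\<Sum>W\<in>\<S>. CARD('a) ^ (k + 1) - 1)"
    using card_hyperplanes[OF sub(1)] sub(2) by (intro sum.cong) auto
  also have "\<dots> = CARD('a) ^ CARD('n) - 1" using card_spread[OF assms(1)] by simp
  finally show ?thesis .
qed

lemma resolving_set_spread_hyperplanes:
  fixes \<S> :: "('a::{field,finite} ^ 'n) set set"
  assumes "spread (k + 1) \<S>"
  shows "resolving_set (with_proj (grassmann_graph k))
    (\<Union>W\<in>\<S>. {U. vec.subspace U \<and> U \<subseteq> W \<and> vec.dim U = k})"
    (is "resolving_set ?G ?M")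
proof -
  note sub = spread_member[OF assms(1)]
  have verts: "verts ?G = k_subspaces k" by (simp add: grassmann_graph_def)
  have MV: "?M \<subseteq> k_subspaces k" by (auto simp: k_subspaces_def)
  have resolved: "u = w" if u: "u \<in> k_subspaces k" and w: "w \<in> k_subspaces k"
    and d: "\<forall>s\<in>?M. graph_dist ?G u s = graph_dist ?G w s" for u w
  proof -
    have uw: "vec.subspace u" "vec.subspace w" "vec.dim u = k" "vec.dim w = k"
      using u w by (auto simp: k_subspaces_def)
    have dims: "vec.dim (u \<inter> s) = vec.dim (w \<inter> s)" if "s \<in> ?M" for s
    proof -
      have s: "s \<in> k_subspaces k" using that MV by blast
      have "graph_dist ?G u s = graph_dist ?G w s" using d that by blast
      then have "k - vec.dim (u \<inter> s) = k - vec.dim (w \<inter> s)"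
        unfolding graph_dist_grassmann[OF u s] graph_dist_grassmann[OF w s] by simp
      \<comment> \<open>The bounds by \<open>k\<close> make the truncated subtraction injective.\<close>
      moreover have "vec.dim (u \<inter> s) \<le> k" "vec.dim (w \<inter> s) \<le> k"
        using uw vec.dim_subset[of "u \<inter> s" u] vec.dim_subset[of "w \<inter> s" w] by auto
      ultimately show ?thesis by simp
    qed
    have sections: "u \<inter> W = w \<inter> W" if W: "W \<in> \<S>" for W
    proof (rule subspace_eq_if_hyperplane_sections)
      show "vec.subspace (u \<inter> W)" "vec.subspace (w \<inter> W)" "vec.subspace W"
        using uw sub[OF W] by (auto intro: vec.subspace_inter)
      \<comment> \<open>Here the dimension \<open>k + 1\<close> of the spread elements matters: \<open>W\<close> does not fit into \<open>u\<close> or \<open>w\<close>.\<close>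
      show "u \<inter> W \<subset> W" "w \<inter> W \<subset> W"
        using uw sub[OF W] vec.dim_subset[of W u] vec.dim_subset[of W w] by auto
      fix U assume U: "vec.subspace U" "U \<subseteq> W" "vec.dim U + 1 = vec.dim W"
      then have "U \<in> ?M" using W sub[OF W] by auto
      moreover have "u \<inter> W \<inter> U = u \<inter> U" "w \<inter> W \<inter> U = w \<inter> U" using U by auto
      ultimately show "vec.dim (u \<inter> W \<inter> U) = vec.dim (w \<inter> W \<inter> U)" using dims by simp
    qed
    have "x \<in> u \<longleftrightarrow> x \<in> w" for x
    proof (cases "x = 0")
      case True
      then show ?thesis using vec.subspace_0[OF uw(1)] vec.subspace_0[OF uw(2)] by simp
    next
      case False
      then obtain W where W: "W \<in> \<S>" "x \<in> W" by (rule spread_cover[OF assms])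
      from sections[OF W(1)] W(2) show ?thesis by blast
    qed
    then show ?thesis by blast
  qed
  show ?thesis
    unfolding resolving_set_def verts
  proof (intro conjI ballI)
    show "finite ?M" by simp
    show "?M \<subseteq> k_subspaces k" by (rule MV)
    fix u w :: "('a ^ 'n) set" assume "u \<in> k_subspaces k" "w \<in> k_subspaces k"
    from resolved[OF this]
    show "(\<forall>s\<in>?M. graph_dist ?G u s = graph_dist ?G w s) \<longleftrightarrow> u = w" by blast
  qed
qed

theorem proposition9:
  fixes q n k :: nat
    and \<S> \<M> :: "('a::{field,finite} ^ 'n) set set"
  assumes "q = CARD('a)"
    and "n = CARD('n)"
    and "k \<ge> 2"
    and "(k + 1) dvd n"
    and "spread (k + 1) \<S>"
    and "\<M> = (\<Union>W\<in>\<S>. {U. vec.subspace U \<and> U \<subseteq> W \<and> vec.dim U = k})"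
  shows "resolving_set (with_proj (grassmann_graph k)) \<M> \<and>
    real (card \<M>) = gaussian_binomial q n 1 \<and>
    gaussian_binomial q n 1 = (real q ^ n - 1) / (real q - 1)"
proof -
  \<comment> \<open>A field has at least two elements, so \<open>q - 1\<close> can be divided out.\<close>
  have "card {0, 1 :: 'a} \<le> CARD('a)" by (intro card_mono) auto
  then have q: "q \<ge> 2" using assms(1) by simp
  have "card \<M> * (q - 1) = q ^ n - 1"
    using card_spread_hyperplanes[of k \<S>] assms by simp
  then have "real (card \<M> * (q - 1)) = real (q ^ n - 1)" by simp
  then have "real (card \<M>) * (real q - 1) = real q ^ n - 1"
    using q by (simp add: of_nat_diff)
  then have "real (card \<M>) = (real q ^ n - 1) / (real q - 1)"
    using q by (simp add: field_simps)
  moreover have "gaussian_binomial q n 1 = (real q ^ n - 1) / (real q - 1)"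
    by (simp add: gaussian_binomial_def)
  ultimately show ?thesis
    using resolving_set_spread_hyperplanes[OF assms(5)] assms(6) by simp
qed

end
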